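(* Let $F$ be a loopless graph (parallel edges allowed) and let $J$ be a simple graph on the same vertex set, with $e(F)>0$ and $\operatorname{supp}(F)\subseteq J$. Suppose that $J$ is KNRS and that some subgroup $\Gamma\le\operatorname{Aut}(J)$ acts transitively on $E(J)$. Let $q\ge e(J)/e(F)$ be a real number. Then for every $\rho\in[0,1]$ and every $\rho$-locally dense graphon $W$, $$t(F,W^{\circ q})\ge\rho^{q\,e(F)}.$$ Moreover, if either $q>e(J)/e(F)$ or $J$ is KNRS-forcing, then for $0<\rho<1$ and a $\rho$-locally dense graphon $W$, equality $t(F,W^{\circ q})=\rho^{q\,e(F)}$ holds if and only if $W=\rho$ almost everywhere.
   Context: Graphs are finite and loopless. For a graph $F$ with possible parallel edges, $e(F)=|E(F)|$ counts edges with multiplicity, and $\operatorname{supp}(F)$ is the simple graph obtained by keeping one copy of each edge. A graphon is a symmetric measurable function $W:[0,1]^2\to[0,1]$. For real $q>0$, $W^{\circ q}(x,y)=W(x,y)^q$. For a graph $F$ and a bounded nonnegative symmetric measurable $K:[0,1]^2\to\mathbb{R}$, $$t(F,K)=\int_{[0,1]^{V(F)}}\prod_{ij\in E(F)}K(x_i,x_j)\prod_{i\in V(F)}dx_i,$$ with the product over edges taken with multiplicity. For $\rho\in[0,1]$, a graphon $W$ is $\rho$-locally dense if $\int_{S\times S}W(x,y)\,dx\,dy\ge\rho\,\lambda(S)^2$ for every measurable $S\subseteq[0,1]$, where $\lambda$ is Lebesgue measure. A graph $H$ is KNRS if $t(H,W)\ge\rho^{e(H)}$ for every $\rho\in[0,1]$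 and every $\rho$-locally dense graphon $W$. A KNRS graph $H$ is KNRS-forcing if, for $\rho\in(0,1)$ and $W$ a $\rho$-locally dense graphon, equality $t(H,W)=\rho^{e(H)}$ implies $W=\rho$ a.e. *)

theory Defs
  imports
    "HOL-Analysis.Analysis"
    "HOL-Library.Multiset"
    "HOL-Algebra.Bij"
begin

section \<open>Finite loopless graphs with parallel edges\<close>

text \<open>
  Parallel edges are recorded as multiplicities in a multiset of unordered pairs of vertices.
\<close>

record 'v pre_graph =
  verts :: "'v set"
  edges :: "'v set multiset"

definition loopless_graph :: "'v pre_graph \<Rightarrow> bool" where
  "loopless_graph G \<longleftrightarrow>
     finite (verts G) \<and> (\<forall>e \<in># edges G. e \<subseteq> verts G \<and> card e = 2)"

definition simple_graph :: "'v pre_graph \<Rightarrow> bool" where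
  "simple_graph G \<longleftrightarrow> loopless_graph G \<and> (\<forall>e. count (edges G) e \<le> 1)"

definition num_edges :: "'v pre_graph \<Rightarrow> nat" where
  "num_edges G = size (edges G)"

definition supp_graph :: "'v pre_graph \<Rightarrow> 'v pre_graph" where
  "supp_graph G = \<lparr>verts = verts G, edges = mset_set (set_mset (edges G))\<rparr>"

definition subgraph_of :: "'v pre_graph \<Rightarrow> 'v pre_graph \<Rightarrow> bool" where
  "subgraph_of G H \<longleftrightarrow> verts G \<subseteq> verts H \<and> edges G \<subseteq># edges H"

text \<open>
  Automorphisms are extensional bijections of the vertex set (as in \<^const>\<open>BijGroup\<close>);
  they act on an edge by taking images.
\<close>

definition graph_auts :: "'v pre_graph \<Rightarrow> ('v \<Rightarrow> 'v) set" where
  "graph_auts G = {f \<in> Bij (verts G). image_mset (\<lambda>e. f ` e) (edges G) = edges G}"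

definition Aut_group :: "'v pre_graph \<Rightarrow> ('v \<Rightarrow> 'v) monoid" where
  "Aut_group G = BijGroup (verts G) \<lparr>carrier := graph_auts G\<rparr>"

definition edge_transitive :: "('v \<Rightarrow> 'v) set \<Rightarrow> 'v pre_graph \<Rightarrow> bool" where
  "edge_transitive \<Gamma> G \<longleftrightarrow> (\<forall>e \<in># edges G. \<forall>e' \<in># edges G. \<exists>f \<in> \<Gamma>. f ` e = e')"


section \<open>Graphons and homomorphism densities\<close>

text \<open>
  Kernels and graphons are total functions whose values outside the unit square are irrelevant.
  Measurability is Lebesgue measurability.
\<close>

definition graphon :: "(real \<Rightarrow> real \<Rightarrow> real) \<Rightarrow> bool" where
  "graphon W \<longleftrightarrow>
     (\<lambda>p. W (fst p) (snd p)) \<in> borel_measurable (lebesgue_on ({0..1} \<times> {0..1})) \<and>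
     (\<forall>x\<in>{0..1}. \<forall>y\<in>{0..1}. W x y = W y x \<and> W x y \<in> {0..1})"

definition kernel_powr :: "(real \<Rightarrow> real \<Rightarrow> real) \<Rightarrow> real \<Rightarrow> real \<Rightarrow> real \<Rightarrow> real" where
  "kernel_powr W q = (\<lambda>x y. W x y powr q)"

text \<open>
  The factor \<open>K (x i) (x j)\<close> of the edge \<open>{i, j}\<close>. For a kernel that is symmetric on the unit
  square the chosen order of the two endpoints is irrelevant, see \<open>edge_factor_doubleton\<close>.
\<close>

definition edge_factor :: "(real \<Rightarrow> real \<Rightarrow> real) \<Rightarrow> ('v \<Rightarrow> real) \<Rightarrow> 'v set \<Rightarrow> real" where
  "edge_factor K x e = (let p = (SOME p. e = {fst p, snd p}) in K (x (fst p)) (x (snd p)))"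

lemma edge_factor_doubleton:
  assumes "K (x i) (x j) = K (x j) (x i)"
  shows "edge_factor K x {i, j} = K (x i) (x j)"
proof -
  define p where "p = (SOME p. {i, j} = {fst p, snd p})"
  have "{i, j} = {fst p, snd p}"
    unfolding p_def by (rule someI[of _ "(i, j)"]) simp
  then have "(fst p = i \<and> snd p = j) \<or> (fst p = j \<and> snd p = i)"
    by (auto simp: doubleton_eq_iff)
  then show ?thesis
    using assms unfolding edge_factor_def Let_def p_def[symmetric] by auto
qed

text \<open>
  The completion turns the product measure into Lebesgue measure on the cube; without it the
  integrand need not be measurable for a Lebesgue measurable kernel.
\<close>

definition hom_density :: "'v pre_graph \<Rightarrow> (real \<Rightarrow> real \<Rightarrow> real) \<Rightarrow> real" where
  "hom_density F K =
     (LINT x | completion (PiM (verts F) (\<lambda>_. lebesgue_on {0..1})).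
        (\<Prod>e \<in># edges F. edge_factor K x e))"

definition locally_dense :: "real \<Rightarrow> (real \<Rightarrow> real \<Rightarrow> real) \<Rightarrow> bool" where
  "locally_dense \<rho> W \<longleftrightarrow>
     (\<forall>S \<in> sets lebesgue. S \<subseteq> {0..1} \<longrightarrow>
        (LINT p:S \<times> S|lebesgue. W (fst p) (snd p)) \<ge> \<rho> * (measure lebesgue S)\<^sup>2)"

definition ae_constant :: "(real \<Rightarrow> real \<Rightarrow> real) \<Rightarrow> real \<Rightarrow> bool" where
  "ae_constant W c \<longleftrightarrow> (AE p in lebesgue_on ({0..1} \<times> {0..1}). W (fst p) (snd p) = c)"

definition KNRS :: "'v pre_graph \<Rightarrow> bool" where
  "KNRS H \<longleftrightarrow>
     (\<forall>\<rho>\<in>{0..1}. \<forall>W. graphon W \<and> locally_dense \<rho> W \<longrightarrow> hom_density H W \<ge> \<rho> ^ num_edges H)"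

definition KNRS_forcing :: "'v pre_graph \<Rightarrow> bool" where
  "KNRS_forcing H \<longleftrightarrow> KNRS H \<and>
     (\<forall>\<rho>\<in>{0<..<1}. \<forall>W. graphon W \<and> locally_dense \<rho> W \<and> hom_density H W = \<rho> ^ num_edges H
        \<longrightarrow> ae_constant W \<rho>)"

end

theory Submission
  imports Defs "HOL-Probability.Infinite_Product_Measure"
begin

text \<open>
  Write \<open>m\<close> and \<open>M\<close> for the numbers of edges of \<open>F\<close> and \<open>J\<close>, and put \<open>p = q * m / M\<close>, so that
  \<open>p \<ge> 1\<close>. For a point \<open>x\<close> of the cube let \<open>G x\<close> be the product of \<open>W\<close> over the edges of \<open>J\<close>.

  The inequality comes from symmetrizing \<open>F\<close> under \<open>\<Gamma>\<close>. Permuting the coordinates of the cube by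
  an automorphism \<open>\<gamma>\<close> of \<open>J\<close> does not change the integral that defines \<open>t(F, W\<^sup>q)\<close>, so this density
  is the integral of the arithmetic mean, over \<open>\<gamma> \<in> \<Gamma>\<close>, of the integrands of the relabelled graphs
  \<open>\<gamma> F\<close>. The geometric mean of these integrands is a power of \<open>G\<close>: by transitivity the images of a
  single edge cover every edge of \<open>J\<close> equally often, so each edge of \<open>J\<close> receives the same exponent,
  namely \<open>p\<close> (\<open>orbit_prod_power\<close>, \<open>orbit_geometric_mean\<close>). The inequality of arithmetic and
  geometric means, Jensen's inequality and the KNRS property of \<open>J\<close> now give
  \<open>t(F, W\<^sup>q) \<ge> \<integral> G\<^sup>p \<ge> (\<integral> G)\<^sup>p = t(J, W)\<^sup>p \<ge> \<rho> powr (M * p) = \<rho> powr (q * m)\<close>.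

  If the two ends agree for some \<open>0 < \<rho> < 1\<close>, then \<open>t(J, W) = \<rho>\<^sup>M\<close>, which settles the case where
  \<open>J\<close> is KNRS-forcing. If instead \<open>p > 1\<close>, then equality in Jensen's inequality makes \<open>G\<close> equal to
  \<open>\<rho>\<^sup>M\<close> almost everywhere. As \<open>W \<le> 1\<close>, every factor of \<open>G\<close> is then at least \<open>\<rho>\<^sup>M\<close>, and
  \<open>w = ln W - ln \<rho>\<close> is a bounded kernel whose sum over the edges of \<open>J\<close> vanishes almost everywhere.
  Integrating this sum over \<open>S\<^sup>V\<close>, where \<open>V\<close> is the vertex set, shows that \<open>w\<close> has integral \<open>0\<close> over
  \<open>S \<times> S\<close> for every measurable \<open>S\<close>; by polarization the same is true on all rectangles, and so
  \<open>w = 0\<close> almost everywhere (\<open>edge_product_constant_imp_kernel_constant\<close>).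

  The measure-theoretic groundwork replaces the Lebesgue measurable \<open>W\<close> by a Borel version \<open>K\<close>. The
  integrands built from \<open>K\<close> are measurable for the product measure itself, so that Fubini's theorem
  and changes of variables apply without the completion.
\<close>

section \<open>The unit cube and its two-dimensional marginals\<close>

abbreviation unit_measure :: "real measure" where
  "unit_measure \<equiv> lebesgue_on {0..1}"

abbreviation cube_measure :: "'v set \<Rightarrow> ('v \<Rightarrow> real) measure" where
  "cube_measure V \<equiv> Pi\<^sub>M V (\<lambda>_. unit_measure)"

lemma prob_space_unit_measure: "prob_space unit_measure"
  by (rule prob_spaceI) (simp add: emeasure_restrict_space)

interpretation unit: prob_space unit_measure
  by (rule prob_space_unit_measure)

interpretation unit_square: pair_prob_space unit_measure unit_measure ..

interpretation cube: product_prob_space "\<lambda>_. unit_measure" V for V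
  by unfold_locales

lemma measurable_ident_unit: "(\<lambda>x. x) \<in> unit_measure \<rightarrow>\<^sub>M borel"
  using id_borel_measurable_lebesgue_on[of "{0..1}"] by (simp add: id_def)

lemma distr_unit_measure:
  "distr unit_measure borel (\<lambda>x. x) = density lborel (indicator {0..1})"
proof (rule measure_eqI)
  fix A :: "real set"
  assume "A \<in> sets (distr unit_measure borel (\<lambda>x. x))"
  then have A: "A \<in> sets borel"
    by simp
  have "emeasure (distr unit_measure borel (\<lambda>x. x)) A = emeasure unit_measure (A \<inter> {0..1})"
    using A measurable_ident_unit by (simp add: emeasure_distr)
  also have "\<dots> = emeasure lborel (A \<inter> {0..1})"
    using A by (simp add: emeasure_restrict_space)
  also have "\<dots> = (\<integral>\<^sup>+ x. indicator {0..1} x * indicator A x \<partial>lborel)"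
    using A by (simp flip: nn_integral_indicator indicator_inter_arith add: Int_commute)
  also have "\<dots> = emeasure (density lborel (indicator {0..1})) A"
    using A by (simp add: emeasure_density)
  finally show "emeasure (distr unit_measure borel (\<lambda>x. x)) A =
      emeasure (density lborel (indicator {0..1})) A" .
qed simp

lemma measurable_ident_square:
  "(\<lambda>p. p) \<in> unit_measure \<Otimes>\<^sub>M unit_measure \<rightarrow>\<^sub>M borel"
  unfolding borel_prod[symmetric]
  by (rule measurable_pair) (auto simp: comp_def intro: measurable_compose[OF measurable_fst measurable_ident_unit]
      measurable_compose[OF measurable_snd measurable_ident_unit])

text \<open>
  The product of two copies of Lebesgue measure on the unit interval is not complete, so it differs
  from Lebesgue measure on the square. The two measures agree on Borel sets, and this is enough to
  compare their null sets.
\<close>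

lemma distr_unit_square:
  "distr (unit_measure \<Otimes>\<^sub>M unit_measure) borel (\<lambda>p. p) =
     density lborel (indicator ({0..1} \<times> {0..1}))"
proof -
  let ?D = "distr unit_measure borel (\<lambda>x. x)"
  have prob: "prob_space ?D"
    by (rule unit.prob_space_distr[OF measurable_ident_unit])
  then have sf: "sigma_finite_measure ?D"
    by (simp add: prob_space_imp_sigma_finite)
  have "distr (unit_measure \<Otimes>\<^sub>M unit_measure) (borel \<Otimes>\<^sub>M borel) (\<lambda>(x, y). (x, y)) = ?D \<Otimes>\<^sub>M ?D"
    by (rule pair_measure_distr[OF measurable_ident_unit measurable_ident_unit sf, symmetric])
  also have "\<dots> = density lborel (indicator {0..1}) \<Otimes>\<^sub>M density lborel (indicator {0..1})"
    by (simp add: distr_unit_measure)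
  also have "\<dots> = density (lborel \<Otimes>\<^sub>M lborel) (\<lambda>(x, y). indicator {0..1} x * indicator {0..1} y)"
    using sf unfolding distr_unit_measure
    by (intro pair_measure_density) (auto intro: sigma_finite_lborel)
  also have "(\<lambda>(x, y). indicator {0..1} x * indicator {0..1} y :: ennreal) =
      indicator ({0..1 :: real} \<times> {0..1 :: real})"
    by (auto simp: fun_eq_iff indicator_def)
  finally show ?thesis
    by (simp add: lborel_prod borel_prod)
qed

lemma AE_unit_square_iff:
  assumes "N \<in> sets borel"
  shows "(AE p in unit_measure \<Otimes>\<^sub>M unit_measure. p \<in> N) \<longleftrightarrow>
    (AE p in lebesgue_on ({0..1} \<times> {0..1}). p \<in> N)"
proof -
  have "(AE p in unit_measure \<Otimes>\<^sub>M unit_measure. p \<in> N) \<longleftrightarrow>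
      (AE p in distr (unit_measure \<Otimes>\<^sub>M unit_measure) borel (\<lambda>p. p). p \<in> N)"
    using assms by (subst AE_distr_iff[OF measurable_ident_square]) simp_all
  also have "\<dots> \<longleftrightarrow> (AE p in lborel. p \<in> {0..1} \<times> {0..1} \<longrightarrow> p \<in> N)"
    unfolding distr_unit_square
    by (subst AE_density) (auto simp: indicator_def borel_Times intro!: AE_cong borel_measurable_indicator)
  also have "\<dots> \<longleftrightarrow> (AE p in lebesgue_on ({0..1} \<times> {0..1}). p \<in> N)"
    by (subst AE_restrict_space_iff) (auto simp: AE_completion_iff borel_Times)
  finally show ?thesis .
qed

text \<open>
  A Lebesgue null set of the square need not be measurable for the product measure, but it is
  contained in a Borel null set.
\<close>

lemma AE_unit_square:
  assumes "AE p in lebesgue_on ({0..1} \<times> {0..1}). Q p"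
  shows "AE p in unit_measure \<Otimes>\<^sub>M unit_measure. Q p"
proof -
  have "AE p in lborel. p \<in> {0..1} \<times> {0..1} \<longrightarrow> Q p"
    using assms by (subst (asm) AE_restrict_space_iff) (auto simp: AE_completion_iff borel_Times)
  then obtain N where N: "{p. \<not> (p \<in> {0..1} \<times> {0..1} \<longrightarrow> Q p)} \<subseteq> N" "N \<in> null_sets lborel"
    unfolding eventually_ae_filter by auto
  have "AE p in lborel. p \<in> - N"
    using AE_not_in[OF N(2)] by simp
  then have "AE p in lebesgue_on ({0..1} \<times> {0..1}). p \<in> - N"
    by (subst AE_restrict_space_iff) (auto simp: AE_completion_iff borel_Times)
  then have "AE p in unit_measure \<Otimes>\<^sub>M unit_measure. p \<in> - N"
    using N(2) by (subst AE_unit_square_iff) auto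
  moreover have "AE p in unit_measure \<Otimes>\<^sub>M unit_measure. p \<in> {0..1} \<times> {0..1}"
    by (rule AE_I2) (simp add: space_pair_measure)
  ultimately show ?thesis
    by eventually_elim (use N(1) in auto)
qed

lemma distr_cube_pair:
  assumes "i \<in> V" "j \<in> V" "i \<noteq> j"
  shows "distr (cube_measure V) (unit_measure \<Otimes>\<^sub>M unit_measure) (\<lambda>x. (x i, x j)) =
    unit_measure \<Otimes>\<^sub>M unit_measure"
proof (rule pair_measure_eqI[symmetric])
  have meas: "(\<lambda>x. (x i, x j)) \<in> cube_measure V \<rightarrow>\<^sub>M unit_measure \<Otimes>\<^sub>M unit_measure"
    using assms by simp
  fix S T assume ST: "S \<in> sets unit_measure" "T \<in> sets unit_measure"
  have "emeasure (distr (cube_measure V) (unit_measure \<Otimes>\<^sub>M unit_measure) (\<lambda>x. (x i, x j))) (S \<times> T) =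
      emeasure (cube_measure V)
        {x \<in> space (cube_measure V). \<forall>k\<in>{i, j}. x k \<in> (if k = i then S else T)}"
    using ST assms by (subst emeasure_distr[OF meas]) (auto intro!: arg_cong2[where f = emeasure])
  also have "\<dots> = (\<Prod>k\<in>{i, j}. emeasure unit_measure (if k = i then S else T))"
    using assms ST by (intro cube.emeasure_PiM_Collect) auto
  also have "\<dots> = emeasure unit_measure S * emeasure unit_measure T"
    using assms by simp
  finally show "emeasure unit_measure S * emeasure unit_measure T =
      emeasure (distr (cube_measure V) (unit_measure \<Otimes>\<^sub>M unit_measure) (\<lambda>x. (x i, x j))) (S \<times> T)"
    by simp
qed (simp_all add: prob_space_imp_sigma_finite prob_space_unit_measure)

text \<open>
  Pairs of distinct coordinates of a point of the cube are distributed according to the product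
  measure on the square. This is where looplessness of the graphs enters: on the diagonal, a
  property that holds almost everywhere on the square may fail everywhere.
\<close>

lemma AE_cube_pair:
  assumes "AE p in lebesgue_on ({0..1} \<times> {0..1}). Q p" "i \<in> V" "j \<in> V" "i \<noteq> j"
  shows "AE x in cube_measure V. Q (x i, x j)"
proof (rule AE_distrD[where P = Q])
  show "(\<lambda>x. (x i, x j)) \<in> cube_measure V \<rightarrow>\<^sub>M unit_measure \<Otimes>\<^sub>M unit_measure"
    using assms by simp
  show "AE p in distr (cube_measure V) (unit_measure \<Otimes>\<^sub>M unit_measure) (\<lambda>x. (x i, x j)). Q p"
    by (subst distr_cube_pair[OF assms(2-4)]) (rule AE_unit_square[OF assms(1)])
qed

text \<open>
  In a complete measure space, measurability passes to every function that is almost everywhere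
  equal to a measurable one; so \<open>f\<close> inherits it from \<open>g\<close>.
\<close>

lemma integral_completion_AE_eq:
  fixes f g :: "'a \<Rightarrow> real"
  assumes "AE x in M. f x = g x" and g: "g \<in> borel_measurable M"
  shows "integral\<^sup>L (completion M) f = integral\<^sup>L M g"
proof -
  have AE: "AE x in completion M. f x = g x"
    using assms by (simp add: AE_completion)
  have "f \<in> borel_measurable (completion M)"
  proof (rule measurableI)
    fix B :: "real set" assume B: "B \<in> sets borel"
    show "f -` B \<inter> space (completion M) \<in> sets (completion M)"
    proof (rule completion.in_sets_AE)
      show "AE x in completion M. x \<in> g -` B \<inter> space M \<longleftrightarrow> x \<in> f -` B \<inter> space (completion M)"
        using AE by eventually_elim simp
      show "g -` B \<inter> space M \<in> sets (completion M)"
        using g B by (auto intro: measurable_sets)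
    qed simp
  qed simp
  with AE g have "integral\<^sup>L (completion M) f = integral\<^sup>L (completion M) g"
    by (intro integral_cong_AE) (simp_all add: measurable_completion)
  with g show ?thesis
    by (simp add: integral_completion)
qed


section \<open>Borel versions of graphons\<close>

text \<open>
  Symmetry is required at all points because an automorphism may reverse the order in which the
  endpoints of an edge enter its factor.
\<close>

definition borel_kernel :: "(real \<Rightarrow> real \<Rightarrow> real) \<Rightarrow> bool" where
  "borel_kernel K \<longleftrightarrow>
     (\<lambda>p. K (fst p) (snd p)) \<in> borel_measurable borel \<and> (\<forall>x y. K x y = K y x)"

lemma borel_kernel_measurable_unit_square:
  assumes "borel_kernel K"
  shows "(\<lambda>p. K (fst p) (snd p)) \<in> borel_measurable (unit_measure \<Otimes>\<^sub>M unit_measure)"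
proof -
  have "(\<lambda>p. K (fst p) (snd p)) \<in> borel_measurable borel"
    using assms by (simp add: borel_kernel_def)
  from measurable_compose[OF measurable_ident_square this] show ?thesis .
qed

lemma borel_kernel_powr: "borel_kernel K \<Longrightarrow> borel_kernel (kernel_powr K q)"
  unfolding borel_kernel_def kernel_powr_def by auto

text \<open>
  A Borel function that agrees with \<open>W\<close> almost everywhere on the square need be neither symmetric nor
  \<open>[0,1]\<close>-valued. Both are arranged everywhere by evaluating it only at \<open>(min x y, max x y)\<close> and
  truncating. Since reflection in the diagonal preserves null sets, this does not affect the
  agreement with \<open>W\<close>.
\<close>

lemma graphon_borel_version:
  assumes "graphon W"
  obtains K where "borel_kernel K" "\<And>x y. 0 \<le> K x y" "\<And>x y. K x y \<le> 1"
    "AE p in lebesgue_on ({0..1} \<times> {0..1}). W (fst p) (snd p) = K (fst p) (snd p)"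
proof -
  let ?Q = "{0..1} \<times> {0..1} :: (real \<times> real) set"
  have Qb: "?Q \<in> sets borel"
    by (simp add: borel_Times)
  then have Q: "?Q \<in> sets lebesgue"
    by simp
  have "(\<lambda>p. if p \<in> ?Q then W (fst p) (snd p) else 0) \<in> borel_measurable (lebesgue_on UNIV)"
    using assms unfolding graphon_def by (subst borel_measurable_if_lebesgue_on) (use Q in auto)
  then have "(\<lambda>p. if p \<in> ?Q then W (fst p) (snd p) else 0) \<in> borel_measurable (completion lborel)"
    by (simp add: lebesgue_on_UNIV_eq)
  from completion_ex_borel_measurable_real[OF this] obtain g where
    g: "g \<in> borel_measurable lborel" and
    Wg: "AE p in lborel. (if p \<in> ?Q then W (fst p) (snd p) else 0) = g p"
    by auto
  have gb: "g \<in> borel_measurable borel"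
    using g by simp
  define K where "K x y = max 0 (min 1 (g (min x y, max x y)))" for x y
  have "AE p in distr (lborel \<Otimes>\<^sub>M lborel) (lborel \<Otimes>\<^sub>M lborel) (\<lambda>(x, y). (y, x)).
      (if p \<in> ?Q then W (fst p) (snd p) else 0) = g p"
    by (subst lborel_pair.distr_pair_swap[symmetric]) (subst lborel_prod, rule Wg)
  then have "AE p in lborel \<Otimes>\<^sub>M lborel. (if (snd p, fst p) \<in> ?Q then W (snd p) (fst p) else 0)
      = g (snd p, fst p)"
    by (auto dest!: AE_distrD[rotated] simp: case_prod_beta)
  then have Wg': "AE p in lborel. (if (snd p, fst p) \<in> ?Q then W (snd p) (fst p) else 0)
      = g (snd p, fst p)"
    by (subst (asm) lborel_prod)
  have "AE p in lborel. p \<in> ?Q \<longrightarrow> W (fst p) (snd p) = K (fst p) (snd p)"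
    using Wg Wg'
  proof eventually_elim
    case (elim p)
    obtain x y where p: "p = (x, y)"
      by (cases p)
    show ?case
    proof
      assume "p \<in> ?Q"
      then have xy: "x \<in> {0..1}" "y \<in> {0..1}"
        by (auto simp: p)
      then have W: "W x y = W y x" "0 \<le> W x y" "W x y \<le> 1"
        using assms by (auto simp: graphon_def)
      have "g (x, y) = W x y" "g (y, x) = W x y"
        using elim xy W(1) by (auto simp: p)
      then have "g (min x y, max x y) = W x y"
        by (cases "x \<le> y") (simp_all add: min_def max_def)
      then show "W (fst p) (snd p) = K (fst p) (snd p)"
        using W by (simp add: p K_def)
    qed
  qed
  then have AE: "AE p in lebesgue_on ?Q. W (fst p) (snd p) = K (fst p) (snd p)"
    using Q by (subst AE_restrict_space_iff) (auto simp: AE_completion_iff)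
  have mm: "(\<lambda>p :: real \<times> real. (min (fst p) (snd p), max (fst p) (snd p))) \<in> borel \<rightarrow>\<^sub>M borel"
    unfolding borel_prod[symmetric] by measurable
  have [measurable]: "(\<lambda>p. g (min (fst p) (snd p), max (fst p) (snd p))) \<in> borel_measurable borel"
    using measurable_compose[OF mm gb] by simp
  have "(\<lambda>p. K (fst p) (snd p)) \<in> borel_measurable borel"
    unfolding K_def by measurable
  then have "borel_kernel K"
    by (simp add: borel_kernel_def K_def min.commute max.commute)
  then show ?thesis
    by (rule that) (use AE in \<open>auto simp: K_def\<close>)
qed


section \<open>Sums and products over finite multisets\<close>

lemma prod_mset_unit_interval:
  fixes f :: "'a \<Rightarrow> real"
  assumes "\<And>i. i \<in># A \<Longrightarrow> 0 \<le> f i \<and> f i \<le> 1"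
  shows "0 \<le> (\<Prod>i\<in>#A. f i) \<and> (\<Prod>i\<in>#A. f i) \<le> 1"
  using assms by (induction A) (auto simp: mult_le_one)

lemma prod_mset_nonneg:
  fixes f :: "'a \<Rightarrow> real"
  shows "(\<And>i. i \<in># A \<Longrightarrow> 0 \<le> f i) \<Longrightarrow> 0 \<le> (\<Prod>i\<in>#A. f i)"
  by (induction A) auto

lemma prod_mset_le_factor:
  fixes f :: "'a \<Rightarrow> real"
  assumes "\<And>i. i \<in># A \<Longrightarrow> 0 \<le> f i \<and> f i \<le> 1" and "i \<in># A"
  shows "(\<Prod>i\<in>#A. f i) \<le> f i"
proof -
  obtain A' where A': "A = add_mset i A'"
    using assms(2) by (metis insert_DiffM)
  have "(\<Prod>i\<in>#A'. f i) \<le> 1"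
    using prod_mset_unit_interval[of A' f] assms(1) by (auto simp: A')
  then show ?thesis
    using assms by (simp add: A' mult_left_le)
qed

lemma prod_mset_prod_swap:
  "(\<Prod>e\<in>#A. \<Prod>\<gamma>\<in>\<Gamma>. f \<gamma> e) = (\<Prod>\<gamma>\<in>\<Gamma>. \<Prod>e\<in>#A. f \<gamma> e)"
  by (induction A) (simp_all add: prod.distrib)

lemma ln_prod_mset:
  fixes f :: "'a \<Rightarrow> real"
  assumes "\<And>i. i \<in># A \<Longrightarrow> 0 < f i"
  shows "ln (\<Prod>i\<in>#A. f i) = (\<Sum>i\<in>#A. ln (f i))"
proof -
  have "0 < (\<Prod>i\<in>#A. f i) \<and> ln (\<Prod>i\<in>#A. f i) = (\<Sum>i\<in>#A. ln (f i))"
    using assms by (induction A) (auto simp: ln_mult_pos)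
  then show ?thesis ..
qed

lemma integral_sum_mset:
  fixes f :: "'i \<Rightarrow> 'a \<Rightarrow> real"
  assumes "\<And>i. i \<in># A \<Longrightarrow> integrable M (f i)"
  shows "(LINT x|M. (\<Sum>i\<in>#A. f i x)) = (\<Sum>i\<in>#A. LINT x|M. f i x)"
proof -
  have "integrable M (\<lambda>x. \<Sum>i\<in>#A. f i x) \<and>
      (LINT x|M. (\<Sum>i\<in>#A. f i x)) = (\<Sum>i\<in>#A. LINT x|M. f i x)"
    using assms by (induction A) auto
  then show ?thesis ..
qed

lemma borel_measurable_prod_mset:
  fixes f :: "'i \<Rightarrow> 'a \<Rightarrow> real"
  assumes "\<And>i. i \<in># A \<Longrightarrow> f i \<in> borel_measurable M"
  shows "(\<lambda>x. \<Prod>i\<in>#A. f i x) \<in> borel_measurable M"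
  using assms by (induction A) auto


section \<open>Edge factors and homomorphism densities\<close>

text \<open>
  The ordered pair of endpoints chosen in the definition of an edge factor depends on the edge only,
  so a single choice of \<open>i\<close> and \<open>j\<close> serves all kernels and all points at once.
\<close>

lemma edge_endpoints:
  assumes "card e = 2"
  obtains i j where "i \<noteq> j" "e = {i, j}"
    "\<And>K x. edge_factor K x e = K (x i) (x j)"
proof -
  obtain i j where "e = {i, j}" "i \<noteq> j"
    using assms by (auto simp: card_2_iff)
  define p where "p = (SOME p. e = {fst p, snd p})"
  have "e = {fst p, snd p}"
    unfolding p_def by (rule someI[of _ "(i, j)"]) (simp add: \<open>e = {i, j}\<close>)
  with assms have "fst p \<noteq> snd p"
    by auto
  then show ?thesis
    using \<open>e = {fst p, snd p}\<close> by (rule that) (simp add: edge_factor_def Let_def p_def)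
qed

lemma edge_factor_unit_interval:
  assumes "\<And>x y. 0 \<le> K x y" "\<And>x y. K x y \<le> 1"
  shows "0 \<le> edge_factor K x e \<and> edge_factor K x e \<le> 1"
  using assms by (simp add: edge_factor_def Let_def)

lemma edge_factor_kernel_powr: "edge_factor (kernel_powr K q) x e = edge_factor K x e powr q"
  by (simp add: edge_factor_def kernel_powr_def Let_def)

lemma borel_measurable_edge_factor:
  assumes "borel_kernel K" "e \<subseteq> V" "card e = 2"
  shows "(\<lambda>x. edge_factor K x e) \<in> borel_measurable (cube_measure V)"
proof -
  obtain i j where ij: "i \<noteq> j" "e = {i, j}" "\<And>K x. edge_factor K x e = K (x i) (x j)"
    using edge_endpoints[OF assms(3)] by blast
  have "(\<lambda>x. (x i, x j)) \<in> cube_measure V \<rightarrow>\<^sub>M unit_measure \<Otimes>\<^sub>M unit_measure"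
    using assms(2) ij(2) by simp
  from measurable_compose[OF this borel_kernel_measurable_unit_square[OF assms(1)]]
  have "(\<lambda>x. K (fst (x i, x j)) (snd (x i, x j))) \<in> borel_measurable (cube_measure V)" .
  then show ?thesis
    by (simp add: ij(3))
qed

lemma borel_measurable_edge_product:
  assumes "borel_kernel K" "loopless_graph G"
  shows "(\<lambda>x. \<Prod>e\<in>#edges G. edge_factor K x e) \<in> borel_measurable (cube_measure (verts G))"
  using assms
  by (intro borel_measurable_prod_mset borel_measurable_edge_factor) (auto simp: loopless_graph_def)

lemma AE_edge_factor_eq:
  assumes "AE p in lebesgue_on ({0..1} \<times> {0..1}). W (fst p) (snd p) = K (fst p) (snd p)"
    and "loopless_graph G"
  shows "AE x in cube_measure (verts G). \<forall>e\<in>set_mset (edges G). edge_factor W x e = edge_factor K x e"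
proof (rule AE_finite_allI)
  fix e assume "e \<in># edges G"
  then have e: "e \<subseteq> verts G" "card e = 2"
    using assms(2) by (auto simp: loopless_graph_def)
  obtain i j where ij: "i \<noteq> j" "e = {i, j}" "\<And>K x. edge_factor K x e = K (x i) (x j)"
    using edge_endpoints[OF e(2)] by blast
  show "AE x in cube_measure (verts G). edge_factor W x e = edge_factor K x e"
    unfolding ij(3) using AE_cube_pair[OF assms(1), of i "verts G" j] e(1) ij(1,2) by simp
qed simp

lemma hom_density_borel_version:
  assumes "AE p in lebesgue_on ({0..1} \<times> {0..1}). W (fst p) (snd p) = K (fst p) (snd p)"
    and "borel_kernel K" "loopless_graph G"
  shows "hom_density G W = (LINT x | cube_measure (verts G). (\<Prod>e\<in>#edges G. edge_factor K x e))"
  unfolding hom_density_def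
proof (rule integral_completion_AE_eq)
  show "AE x in cube_measure (verts G).
      (\<Prod>e\<in>#edges G. edge_factor W x e) = (\<Prod>e\<in>#edges G. edge_factor K x e)"
    using AE_edge_factor_eq[OF assms(1,3)]
    by eventually_elim (auto intro!: arg_cong[where f = prod_mset] image_mset_cong)
qed (rule borel_measurable_edge_product[OF assms(2,3)])


section \<open>Averaging over an edge-transitive group\<close>

lemma measurable_permute_cube:
  assumes "bij_betw \<gamma> V V"
  shows "(\<lambda>x. \<lambda>v\<in>V. x (\<gamma> v)) \<in> cube_measure V \<rightarrow>\<^sub>M cube_measure V"
  using assms by (intro measurable_restrict measurable_component_singleton) (auto dest: bij_betwE)

lemma integral_permute_cube:
  fixes f :: "('v \<Rightarrow> real) \<Rightarrow> real"
  assumes "bij_betw \<gamma> V V" "f \<in> borel_measurable (cube_measure V)"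
  shows "(LINT x | cube_measure V. f (\<lambda>v\<in>V. x (\<gamma> v))) = (LINT x | cube_measure V. f x)"
proof -
  have "distr (cube_measure V) (cube_measure V) (\<lambda>x. \<lambda>v\<in>V. x (\<gamma> v)) = cube_measure V"
    using assms by (intro distr_PiM_reindex prob_space_unit_measure)
      (auto simp: bij_betw_def)
  then show ?thesis
    using integral_distr[OF measurable_permute_cube[OF assms(1)] assms(2)] by simp
qed

lemma edge_factor_permute:
  assumes "borel_kernel K" "e \<subseteq> V" "card e = 2"
  shows "edge_factor K (\<lambda>v\<in>V. x (\<gamma> v)) e = edge_factor K x (\<gamma> ` e)"
proof -
  obtain i j where "e = {i, j}"
    using assms(3) by (auto simp: card_2_iff)
  moreover have "K a b = K b a" for a b
    using assms(1) by (simp add: borel_kernel_def)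
  ultimately show ?thesis
    using assms(2) by (simp add: edge_factor_doubleton)
qed

lemma finite_Bij: "finite V \<Longrightarrow> finite (Bij V)"
  by (rule finite_subset[OF _ finite_PiE[of V "\<lambda>_. V"]])
     (auto simp: Bij_def PiE_def dest: bij_betwE)

lemma graph_auts_prod_mset:
  assumes "\<gamma> \<in> graph_auts J"
  shows "(\<Prod>e\<in>#edges J. g (\<gamma> ` e)) = (\<Prod>e\<in>#edges J. g e)"
proof -
  have "(\<Prod>e\<in>#edges J. g (\<gamma> ` e)) = prod_mset (image_mset g (image_mset ((`) \<gamma>) (edges J)))"
    by (simp add: image_mset.compositionality comp_def)
  with assms show ?thesis
    by (simp add: graph_auts_def)
qed

text \<open>
  The product of \<open>g\<close> over the orbit of an edge \<open>e\<close> is the same for all edges, because right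
  multiplication by an element that maps \<open>e\<close> to \<open>e'\<close> permutes \<open>\<Gamma>\<close>. Multiplying these equal products
  over all edges and exchanging the two products gives the right-hand side, since each element of
  \<open>\<Gamma>\<close> permutes the edges of \<open>J\<close>. This double counting replaces the computation of stabilizers.
\<close>

lemma orbit_prod_power:
  fixes g :: "'v set \<Rightarrow> 'a :: comm_semiring_1"
  assumes J: "loopless_graph J" and \<Gamma>: "subgroup \<Gamma> (Aut_group J)" "edge_transitive \<Gamma> J"
    and e: "e \<in># edges J"
  shows "(\<Prod>\<gamma>\<in>\<Gamma>. g (\<gamma> ` e)) ^ num_edges J = (\<Prod>e\<in>#edges J. g e) ^ card \<Gamma>"
proof -
  have auts: "\<gamma> \<in> graph_auts J" if "\<gamma> \<in> \<Gamma>" for \<gamma>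
    using subgroup.subset[OF \<Gamma>(1)] that by (auto simp: Aut_group_def)
  then have bij: "\<gamma> \<in> Bij (verts J)" if "\<gamma> \<in> \<Gamma>" for \<gamma>
    using that by (auto simp: graph_auts_def)
  then have "finite \<Gamma>"
    using J by (auto simp: loopless_graph_def intro: finite_subset[OF _ finite_Bij])
  have const: "(\<Prod>\<gamma>\<in>\<Gamma>. g (\<gamma> ` e')) = (\<Prod>\<gamma>\<in>\<Gamma>. g (\<gamma> ` e))" if e': "e' \<in># edges J" for e'
  proof -
    obtain \<delta> where \<delta>: "\<delta> \<in> \<Gamma>" "\<delta> ` e = e'"
      using \<Gamma>(2)[unfolded edge_transitive_def] e e' by blast
    have im: "compose (verts J) \<gamma> \<delta> ` e = \<gamma> ` e'" for \<gamma>
    proof -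
      have "e \<subseteq> verts J"
        using J e by (auto simp: loopless_graph_def)
      then show ?thesis
        unfolding \<delta>(2)[symmetric] image_image by (intro image_cong) (auto simp: compose_def)
    qed
    have "compose (verts J) \<gamma> \<delta> \<in> \<Gamma>" if "\<gamma> \<in> \<Gamma>" for \<gamma>
      using subgroup.m_closed[OF \<Gamma>(1) that \<delta>(1)] bij[OF that] bij[OF \<delta>(1)]
      by (simp add: Aut_group_def BijGroup_def)
    moreover have "inj_on (\<lambda>\<gamma>. compose (verts J) \<gamma> \<delta>) \<Gamma>"
    proof (rule inj_onI)
      fix \<gamma> \<gamma>' assume \<gamma>: "\<gamma> \<in> \<Gamma>" "\<gamma>' \<in> \<Gamma>"
        and eq: "compose (verts J) \<gamma> \<delta> = compose (verts J) \<gamma>' \<delta>"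
      show "\<gamma> = \<gamma>'"
      proof (rule extensionalityI)
        show "\<gamma> \<in> extensional (verts J)" "\<gamma>' \<in> extensional (verts J)"
          using bij \<gamma> by (auto simp: Bij_def)
        fix v assume "v \<in> verts J"
        then obtain u where "u \<in> verts J" "v = \<delta> u"
          using bij[OF \<delta>(1)] by (auto simp: Bij_def bij_betw_def)
        then show "\<gamma> v = \<gamma>' v"
          using fun_cong[OF eq, of u] by (simp add: compose_def)
      qed
    qed
    ultimately have "bij_betw (\<lambda>\<gamma>. compose (verts J) \<gamma> \<delta>) \<Gamma> \<Gamma>"
      unfolding bij_betw_def using \<open>finite \<Gamma>\<close> by (intro conjI endo_inj_surj) auto
    from prod.reindex_bij_betw[OF this, of "\<lambda>\<gamma>. g (\<gamma> ` e)"] show ?thesis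
      by (simp add: im)
  qed
  have "(\<Prod>\<gamma>\<in>\<Gamma>. g (\<gamma> ` e)) ^ num_edges J = (\<Prod>e'\<in>#edges J. \<Prod>\<gamma>\<in>\<Gamma>. g (\<gamma> ` e'))"
    using const by (simp add: num_edges_def cong: image_mset_cong)
  also have "\<dots> = (\<Prod>\<gamma>\<in>\<Gamma>. \<Prod>e'\<in>#edges J. g (\<gamma> ` e'))"
    by (rule prod_mset_prod_swap)
  also have "\<dots> = (\<Prod>\<gamma>\<in>\<Gamma>. \<Prod>e'\<in>#edges J. g e')"
    by (intro prod.cong refl graph_auts_prod_mset auts)
  also have "\<dots> = (\<Prod>e\<in>#edges J. g e) ^ card \<Gamma>"
    by (rule prod_constant)
  finally show ?thesis .
qed

lemma power_of_powr:
  fixes z u :: real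
  shows "n > 0 \<Longrightarrow> (z powr u) ^ n = z powr (u * n)"
  by (cases "z = 0") (simp_all add: powr_power mult.commute)

text \<open>
  Extracting roots in \<open>orbit_prod_power\<close>, the orbit product of each edge is the product of \<open>g\<close> over
  all edges of \<open>J\<close>, raised to the power \<open>card \<Gamma> / num_edges J\<close>. The \<open>num_edges F\<close> edges of \<open>F\<close>
  contribute equally, and the outer exponent cancels \<open>card \<Gamma>\<close>.
\<close>

lemma orbit_geometric_mean:
  fixes g :: "'v set \<Rightarrow> real" and q :: real
  assumes J: "loopless_graph J" and \<Gamma>: "subgroup \<Gamma> (Aut_group J)" "edge_transitive \<Gamma> J"
    and "finite \<Gamma>" "\<Gamma> \<noteq> {}"
    and F: "set_mset (edges F) \<subseteq> set_mset (edges J)" "num_edges F > 0"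
    and g: "\<And>e. 0 \<le> g e"
  shows "(\<Prod>\<gamma>\<in>\<Gamma>. \<Prod>e\<in>#edges F. g (\<gamma> ` e) powr q) powr (1 / card \<Gamma>) =
    (\<Prod>e\<in>#edges J. g e) powr (q * num_edges F / num_edges J)"
proof -
  define G n where "G = (\<Prod>e\<in>#edges J. g e)" and "n = card \<Gamma>"
  have "n > 0"
    using assms(4,5) by (simp add: n_def card_gt_0_iff)
  have "edges F \<noteq> {#}"
    using F(2) by (auto simp: num_edges_def)
  then have M: "num_edges J > 0"
    using F(1) by (auto simp: num_edges_def nonempty_has_size[symmetric])
  have "G \<ge> 0"
    unfolding G_def using g by (intro prod_mset_nonneg)
  have c: "(\<Prod>\<gamma>\<in>\<Gamma>. g (\<gamma> ` e)) = G powr (n / num_edges J)" if "e \<in># edges F" for e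
  proof -
    have "(\<Prod>\<gamma>\<in>\<Gamma>. g (\<gamma> ` e)) ^ num_edges J = G ^ n"
      using orbit_prod_power[OF J \<Gamma>, of e g] F(1) that by (auto simp: G_def n_def)
    moreover have "(G powr (n / num_edges J)) ^ num_edges J = G ^ n"
      using \<open>G \<ge> 0\<close> M \<open>n > 0\<close> by (simp add: power_of_powr powr_realpow')
    ultimately have "(\<Prod>\<gamma>\<in>\<Gamma>. g (\<gamma> ` e)) ^ num_edges J = (G powr (n / num_edges J)) ^ num_edges J"
      by simp
    then show ?thesis
      by (rule power_eq_imp_eq_base) (use M g in \<open>simp_all add: prod_nonneg\<close>)
  qed
  have "(\<Prod>\<gamma>\<in>\<Gamma>. \<Prod>e\<in>#edges F. g (\<gamma> ` e) powr q) = (\<Prod>e\<in>#edges F. \<Prod>\<gamma>\<in>\<Gamma>. g (\<gamma> ` e) powr q)"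
    by (rule prod_mset_prod_swap[symmetric])
  also have "\<dots> = (\<Prod>e\<in>#edges F. G powr (q * n / num_edges J))"
    using c g by (intro arg_cong[where f = prod_mset] image_mset_cong)
      (simp add: prod_powr_distrib[symmetric] powr_powr mult.commute)
  also have "\<dots> = G powr (q * n / num_edges J * num_edges F)"
    using F(2) by (simp add: power_of_powr num_edges_def)
  finally show ?thesis
    using \<open>n > 0\<close> by (simp add: powr_powr G_def n_def)
qed


section \<open>The equality case of Jensen's inequality\<close>

text \<open>
  This strict form of Bernoulli's inequality follows from the strict concavity of the logarithm: \<open>s\<close>
  is the convex combination of \<open>a = 1 + p * (s - 1)\<close> and \<open>1\<close> with weights \<open>1 / p\<close> and \<open>1 - 1 / p\<close>,
  whence \<open>ln s > ln a / p\<close>. The proof obtains the latter from \<open>ln y \<le> y - 1\<close> at \<open>y = a / s\<close> and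
  \<open>y = 1 / s\<close>, with weights chosen so that the right-hand sides cancel.
\<close>

lemma powr_above_tangent_strict:
  fixes s p :: real
  assumes "p > 1" "s \<ge> 0" "s \<noteq> 1"
  shows "1 + p * (s - 1) < s powr p"
proof (cases "s = 0 \<or> 1 + p * (s - 1) \<le> 0")
  case True
  then show ?thesis
  proof
    assume "s = 0"
    then show ?thesis
      using assms(1) by simp
  next
    assume "1 + p * (s - 1) \<le> 0"
    then show ?thesis
      using assms(1) by (cases "s = 0") (auto intro: le_less_trans)
  qed
next
  case False
  define a where "a = 1 + p * (s - 1)"
  have "a > 0" "s > 0"
    using False assms(2) by (auto simp: a_def)
  have 1: "ln (a / s) \<le> a / s - 1"
    using \<open>a > 0\<close> \<open>s > 0\<close> by (intro ln_le_minus_one) simp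
  have 2: "ln (1 / s) < 1 / s - 1"
    using ln_le_minus_one[of "1 / s"] ln_eq_minus_one[of "1 / s"] \<open>s > 0\<close> assms(3) by force
  have "ln (a / s) + (p - 1) * ln (1 / s) < (a / s - 1) + (p - 1) * (1 / s - 1)"
    using 1 mult_strict_left_mono[OF 2, of "p - 1"] assms(1) by linarith
  also have "\<dots> = 0"
    using \<open>s > 0\<close> by (simp add: a_def field_simps)
  finally have "ln a < p * ln s"
    using \<open>a > 0\<close> \<open>s > 0\<close> by (simp add: ln_div algebra_simps)
  then have "exp (ln a) < exp (p * ln s)"
    by simp
  then show ?thesis
    using \<open>a > 0\<close> \<open>s > 0\<close> unfolding a_def[symmetric] by (simp add: powr_def)
qed

lemma powr_above_tangent:
  fixes s p :: real
  assumes "p \<ge> 1" "s \<ge> 0"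
  shows "1 + p * (s - 1) \<le> s powr p"
  using powr_above_tangent_strict[of p s] assms by (cases "p = 1"; cases "s = 1") auto

text \<open>
  Integrating the tangent line of \<open>s \<mapsto> s powr p\<close> at the mean of \<open>f\<close> gives Jensen's inequality for this
  power. In case of equality, the nonnegative gap \<open>h\<close> between the power and the tangent line has
  integral zero, so \<open>f\<close> takes values at the point of tangency almost everywhere.
\<close>

context prob_space
begin

lemma
  fixes f :: "'a \<Rightarrow> real"
  assumes f: "f \<in> borel_measurable M" "\<And>x. 0 \<le> f x" "\<And>x. f x \<le> 1" and p: "p \<ge> 1"
  shows expectation_powr_ge: "expectation (\<lambda>x. f x powr p) \<ge> expectation f powr p"
    and expectation_powr_eq_imp_AE_const:
      "p > 1 \<Longrightarrow> expectation f > 0 \<Longrightarrow> expectation (\<lambda>x. f x powr p) = expectation f powr p \<Longrightarrow>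
        AE x in M. f x = expectation f"
proof -
  define t where "t = expectation f"
  define h where "h x = f x powr p - t powr p * (1 + p * (f x / t - 1))" for x
  have "t \<ge> 0"
    using f(2) by (simp add: t_def)
  have int_f: "integrable M f"
    using f by (intro integrable_const_bound[where B = 1]) auto
  have "f x powr p \<le> 1" for x
    using f(2,3)[of x] p by (intro powr_le1) auto
  then have int_p: "integrable M (\<lambda>x. f x powr p)"
    using f(1) by (intro integrable_const_bound[where B = 1]) auto
  have int_h: "integrable M h"
    unfolding h_def using int_f int_p by simp
  have h_eq: "expectation h = expectation (\<lambda>x. f x powr p) - t powr p" if "t > 0"
    unfolding h_def using int_f int_p that by (simp add: prob_space flip: t_def)
  have tangent: "f x powr p = t powr p * (f x / t) powr p" if "t > 0" for x
    using that f(2) by (simp add: powr_divide)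
  have h_nonneg: "h x \<ge> 0" if "t > 0" for x
    unfolding h_def tangent[OF that] right_diff_distrib[symmetric]
    using powr_above_tangent[of p "f x / t"] that f(2)[of x] p by simp
  show "expectation (\<lambda>x. f x powr p) \<ge> expectation f powr p"
  proof (cases "t > 0")
    case True
    then have "expectation h \<ge> 0"
      using h_nonneg by simp
    then show ?thesis
      using h_eq[OF True] by (simp add: t_def)
  next
    case False
    then have "t = 0"
      using \<open>t \<ge> 0\<close> by simp
    then show ?thesis
      by (simp add: t_def)
  qed
  assume "p > 1" and t: "expectation f > 0"
    and "expectation (\<lambda>x. f x powr p) = expectation f powr p"
  then have "t > 0" "expectation h = 0"
    using h_eq by (simp_all add: t_def)
  then have "AE x in M. h x = 0"
    using integral_nonneg_eq_0_iff_AE[OF int_h] h_nonneg by simp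
  then show "AE x in M. f x = expectation f"
  proof eventually_elim
    case (elim x)
    then have "(f x / t) powr p = 1 + p * (f x / t - 1)"
      using \<open>t > 0\<close> unfolding h_def tangent[OF \<open>t > 0\<close>] right_diff_distrib[symmetric] by simp
    then have "f x / t = 1"
      using powr_above_tangent_strict[OF \<open>p > 1\<close>, of "f x / t"] f(2)[of x] \<open>t > 0\<close> by auto
    then show ?case
      using \<open>t > 0\<close> by (simp add: t_def)
  qed
qed

end


section \<open>Kernels with constant edge products\<close>

text \<open>
  Rectangles determine a measure on the product. For \<open>c\<close> larger than the bound of \<open>w\<close>, the function
  \<open>1 + w / c\<close> is a density whose measure agrees with the product measure on all rectangles, and
  densities are unique.
\<close>

lemma (in pair_prob_space) AE_eq_0_if_rectangle_integrals_eq_0: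
  fixes w :: "'a \<times> 'b \<Rightarrow> real"
  assumes w: "w \<in> borel_measurable (M1 \<Otimes>\<^sub>M M2)" "\<And>p. \<bar>w p\<bar> \<le> C"
    and zero: "\<And>A B. A \<in> sets M1 \<Longrightarrow> B \<in> sets M2 \<Longrightarrow>
      (LINT p | (M1 \<Otimes>\<^sub>M M2). w p * indicator (A \<times> B) p) = 0"
  shows "AE p in M1 \<Otimes>\<^sub>M M2. w p = 0"
proof -
  define c where "c = C + 1"
  have "C \<ge> 0"
    using w(2) abs_ge_zero order_trans by blast
  then have "c > 0"
    by (simp add: c_def)
  have pos: "0 \<le> 1 + w p / c" for p
    using w(2)[of p] \<open>c > 0\<close> by (simp add: c_def field_simps abs_le_iff)
  have meas [measurable]: "w \<in> borel_measurable (M1 \<Otimes>\<^sub>M M2)"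
    by fact
  define D where "D = density (M1 \<Otimes>\<^sub>M M2) (\<lambda>p. ennreal (1 + w p / c))"
  have "M1 \<Otimes>\<^sub>M M2 = D"
  proof (rule pair_measure_eqI)
    fix A B assume AB: "A \<in> sets M1" "B \<in> sets M2"
    then have AB' [measurable]: "A \<times> B \<in> sets (M1 \<Otimes>\<^sub>M M2)"
      by simp
    have int: "integrable (M1 \<Otimes>\<^sub>M M2) (\<lambda>p. w p * indicator (A \<times> B) p)"
      using w(2) \<open>C \<ge> 0\<close>
      by (intro integrable_const_bound[where B = C]) (auto simp: indicator_def)
    have "integrable (M1 \<Otimes>\<^sub>M M2) (\<lambda>p. indicator (A \<times> B) p :: real)"
      by (simp add: emeasure_eq_measure)
    moreover have "integrable (M1 \<Otimes>\<^sub>M M2) (\<lambda>p. w p * indicator (A \<times> B) p / c)"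
      using int by simp
    ultimately have int': "integrable (M1 \<Otimes>\<^sub>M M2) (\<lambda>p. (1 + w p / c) * indicator (A \<times> B) p)"
      and int_eq: "(LINT p | (M1 \<Otimes>\<^sub>M M2). (1 + w p / c) * indicator (A \<times> B) p) =
        measure (M1 \<Otimes>\<^sub>M M2) (A \<times> B)"
      using zero[OF AB] by (simp_all add: distrib_right)
    have "emeasure D (A \<times> B) =
        (\<integral>\<^sup>+ p. ennreal ((1 + w p / c) * indicator (A \<times> B) p) \<partial>(M1 \<Otimes>\<^sub>M M2))"
      unfolding D_def using pos
      by (subst emeasure_density) (auto simp: ennreal_mult ennreal_indicator intro!: nn_integral_cong)
    also have "\<dots> = ennreal (LINT p | (M1 \<Otimes>\<^sub>M M2). (1 + w p / c) * indicator (A \<times> B) p)"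
      using int' pos by (intro nn_integral_eq_integral AE_I2 mult_nonneg_nonneg) simp_all
    also have "\<dots> = emeasure (M1 \<Otimes>\<^sub>M M2) (A \<times> B)"
      by (simp only: int_eq emeasure_eq_measure)
    also have "\<dots> = emeasure M1 A * emeasure M2 B"
      using AB by (simp add: M2.emeasure_pair_measure_Times)
    finally show "emeasure M1 A * emeasure M2 B = emeasure D (A \<times> B)" ..
  qed (simp_all add: D_def M1.sigma_finite_measure_axioms M2.sigma_finite_measure_axioms)
  then have "density (M1 \<Otimes>\<^sub>M M2) (\<lambda>p. ennreal (1 + w p / c)) = density (M1 \<Otimes>\<^sub>M M2) (\<lambda>_. 1)"
    by (simp add: D_def density_1)
  then have "AE p in M1 \<Otimes>\<^sub>M M2. ennreal (1 + w p / c) = 1"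
    by (intro density_unique) auto
  then show ?thesis
  proof eventually_elim
    case (elim p)
    then have "1 + w p / c = 1"
      using pos[of p] by simp
    then show ?case
      using \<open>c > 0\<close> by simp
  qed
qed

text \<open>
  This is polarization: as a function of two sets, the integral over \<open>A \<times> B\<close> is additive on disjoint
  unions and symmetric, so its vanishing on the diagonal forces it to vanish on disjoint pairs.
  General pairs are cut up along \<open>A \<inter> B\<close>.
\<close>

lemma rectangle_integrals_eq_0_if_square_integrals_eq_0:
  fixes w :: "real \<times> real \<Rightarrow> real"
  assumes w: "w \<in> borel_measurable (unit_measure \<Otimes>\<^sub>M unit_measure)" "\<And>p. \<bar>w p\<bar> \<le> C"
      "\<And>x y. w (x, y) = w (y, x)"
    and zero: "\<And>S. S \<in> sets unit_measure \<Longrightarrow>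
      (LINT p | (unit_measure \<Otimes>\<^sub>M unit_measure). w p * indicator (S \<times> S) p) = 0"
    and A: "A \<in> sets unit_measure" and B: "B \<in> sets unit_measure"
  shows "(LINT p | (unit_measure \<Otimes>\<^sub>M unit_measure). w p * indicator (A \<times> B) p) = 0"
proof -
  let ?P = "unit_measure \<Otimes>\<^sub>M unit_measure"
  define I where "I S T = (LINT p | ?P. w p * indicator (S \<times> T) p)" for S T
  have C: "0 \<le> C"
    using w(2) abs_ge_zero order_trans by blast
  have int: "integrable ?P (\<lambda>p. w p * indicator (S \<times> T) p)"
    if "S \<in> sets unit_measure" "T \<in> sets unit_measure" for S T
  proof (rule unit_square.integrable_const_bound[where B = C])
    show "(\<lambda>p. w p * indicator (S \<times> T) p) \<in> borel_measurable ?P"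
      using w(1) that by (intro borel_measurable_times borel_measurable_indicator) auto
  qed (use w(2) C in \<open>auto simp: indicator_def\<close>)
  have sym: "I S T = I T S" if "S \<in> sets unit_measure" "T \<in> sets unit_measure" for S T
  proof -
    have "I S T = (LINT p | ?P. (case p of (x, y) \<Rightarrow> w (y, x) * indicator (S \<times> T) (y, x)))"
      unfolding I_def
      using int[OF that] by (intro unit_square.integral_product_swap[symmetric]) auto
    also have "\<dots> = I T S"
      unfolding I_def using w(3)
      by (intro Bochner_Integration.integral_cong) (auto simp: indicator_def)
    finally show ?thesis .
  qed
  have add: "I (S \<union> S') T = I S T + I S' T"
    if "S \<inter> S' = {}" "S \<in> sets unit_measure" "S' \<in> sets unit_measure" "T \<in> sets unit_measure"
    for S S' T
  proof -
    have "I (S \<union> S') T = (LINT p | ?P. w p * indicator (S \<times> T) p + w p * indicator (S' \<times> T) p)"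
      unfolding I_def using that(1)
      by (intro Bochner_Integration.integral_cong) (auto simp: indicator_def)
    then show ?thesis
      using int that by (simp add: I_def)
  qed
  have disj: "I S T = 0"
    if ST: "S \<inter> T = {}" "S \<in> sets unit_measure" "T \<in> sets unit_measure" for S T
  proof -
    have ST': "S \<union> T \<in> sets unit_measure"
      using ST by auto
    have "0 = I (S \<union> T) (S \<union> T)"
      using zero[OF ST'] by (simp add: I_def)
    also have "\<dots> = I S S + I T S + (I S T + I T T)"
      using add[of S T "S \<union> T"] add[of S T S] add[of S T T] ST ST'
        sym[of S "S \<union> T"] sym[of T "S \<union> T"] by simp
    also have "\<dots> = 2 * I S T"
      using zero[of S] zero[of T] sym[of S T] ST by (simp add: I_def)
    finally show ?thesis
      by simp
  qed
  have AB: "A \<inter> B \<in> sets unit_measure" "A - B \<in> sets unit_measure" "B - A \<in> sets unit_measure"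
    using A B by auto
  have "I A B = I (A \<inter> B) B + I (A - B) B"
    using add[of "A \<inter> B" "A - B" B] AB B by (simp add: Int_Diff_disjoint Int_Diff_Un)
  also have "I (A - B) B = 0"
    using disj[of "A - B" B] AB B by auto
  also have "I (A \<inter> B) B = I B (A \<inter> B)"
    using AB B by (intro sym)
  also have "\<dots> = I (A \<inter> B) (A \<inter> B) + I (B - A) (A \<inter> B)"
  proof -
    have "B = A \<inter> B \<union> (B - A)" "A \<inter> B \<inter> (B - A) = {}"
      by auto
    then show ?thesis
      using add[of "A \<inter> B" "B - A" "A \<inter> B"] AB by simp
  qed
  also have "I (B - A) (A \<inter> B) = 0"
    using disj[of "B - A" "A \<inter> B"] AB by auto
  also have "I (A \<inter> B) (A \<inter> B) = 0"
    using zero[OF AB(1)] by (simp add: I_def)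
  finally show ?thesis
    by (simp add: I_def)
qed

text \<open>
  Fubini's theorem on the subcube \<open>S\<^sup>V\<close>: the coordinates other than \<open>i\<close> and \<open>j\<close> integrate out, each
  contributing the measure of \<open>S\<close>.
\<close>

lemma integral_cube_edge_localized:
  assumes w: "borel_kernel w" "\<And>x y. \<bar>w x y\<bar> \<le> C"
    and V: "finite V" "i \<in> V" "j \<in> V" "i \<noteq> j" and S: "S \<in> sets unit_measure"
  shows "integrable (cube_measure V) (\<lambda>x. w (x i) (x j) * (\<Prod>v\<in>V. indicator S (x v)))"
    and "(LINT x | cube_measure V. w (x i) (x j) * (\<Prod>v\<in>V. indicator S (x v))) =
      measure unit_measure S ^ (card V - 2) *
      (LINT p | (unit_measure \<Otimes>\<^sub>M unit_measure). w (fst p) (snd p) * indicator (S \<times> S) p)"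
proof -
  define V' where "V' = V - {i, j}"
  have V_eq: "V = {i, j} \<union> V'" and disj: "{i, j} \<inter> V' = {}" and fin: "finite V'"
    and card: "card V' = card V - 2"
    using V by (auto simp: V'_def card_Diff_subset)
  have C: "0 \<le> C"
    using w(2)[of 0 0] by linarith
  have pair: "(\<lambda>x. (x i, x j)) \<in> cube_measure W \<rightarrow>\<^sub>M unit_measure \<Otimes>\<^sub>M unit_measure"
    if "i \<in> W" "j \<in> W" for W
    using that by simp
  have wm: "(\<lambda>p. w (fst p) (snd p)) \<in> borel_measurable (unit_measure \<Otimes>\<^sub>M unit_measure)"
    by (rule borel_kernel_measurable_unit_square[OF w(1)])
  have wm2: "(\<lambda>x. w (x i) (x j)) \<in> borel_measurable (cube_measure V)"
    using measurable_compose[OF pair[OF V(2,3)] wm] by simp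
  have Sm: "(\<lambda>x. indicator S (x v) :: real) \<in> borel_measurable (cube_measure V)" if "v \<in> V" for v
    using S that by (intro measurable_compose[OF measurable_component_singleton]) auto
  let ?f = "\<lambda>x. w (x i) (x j) * (\<Prod>v\<in>V. indicator S (x v))"
  show int: "integrable (cube_measure V) ?f"
  proof (rule cube.integrable_const_bound[where B = C])
    show "?f \<in> borel_measurable (cube_measure V)"
      using wm2 Sm by (intro borel_measurable_times borel_measurable_prod) auto
    have "\<bar>\<Prod>v\<in>V. indicator S (x v) :: real\<bar> \<le> 1" for x
      by (simp add: abs_prod prod_le_1)
    then have "norm (?f x) \<le> C" for x
      using w(2)[of "x i" "x j"] C unfolding real_norm_def abs_mult
      by (metis abs_ge_zero mult_mono mult.right_neutral)
    then show "AE x in cube_measure V. norm (?f x) \<le> C"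
      by simp
  qed
  have "(LINT x | cube_measure V. ?f x) =
      (LINT x | cube_measure {i, j}. LINT y | cube_measure V'. ?f (merge {i, j} V' (x, y)))"
    unfolding V_eq by (rule cube.product_integral_fold[OF disj _ fin int[unfolded V_eq]]) simp
  also have "\<dots> = (LINT x | cube_measure {i, j}. w (x i) (x j) * indicator S (x i) * indicator S (x j) *
      (LINT y | cube_measure V'. (\<Prod>v\<in>V'. indicator S (y v))))"
  proof (intro Bochner_Integration.integral_cong refl)
    fix x
    have "?f (merge {i, j} V' (x, y)) =
        w (x i) (x j) * indicator S (x i) * indicator S (x j) * (\<Prod>v\<in>V'. indicator S (y v))" for y
    proof -
      have "(\<Prod>v\<in>V. indicator S (merge {i, j} V' (x, y) v) :: real) =
          (\<Prod>v\<in>{i, j}. indicator S (merge {i, j} V' (x, y) v)) *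
          (\<Prod>v\<in>V'. indicator S (merge {i, j} V' (x, y) v))"
        unfolding V_eq using disj fin by (intro prod.union_disjoint) auto
      also have "(\<Prod>v\<in>V'. indicator S (merge {i, j} V' (x, y) v) :: real) = (\<Prod>v\<in>V'. indicator S (y v))"
        using disj by (intro prod.cong) (auto simp: merge_def)
      finally show ?thesis
        using V(4) by (simp add: merge_def mult_ac)
    qed
    then show "(LINT y | cube_measure V'. ?f (merge {i, j} V' (x, y))) =
        w (x i) (x j) * indicator S (x i) * indicator S (x j) *
        (LINT y | cube_measure V'. (\<Prod>v\<in>V'. indicator S (y v)))"
      by simp
  qed
  also have "(LINT y | cube_measure V'. (\<Prod>v\<in>V'. indicator S (y v) :: real)) =
      (\<Prod>v\<in>V'. LINT t | unit_measure. indicator S t)"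
    using fin S by (intro cube.product_integral_prod) (auto simp: unit.emeasure_eq_measure)
  also have "\<dots> = measure unit_measure S ^ (card V - 2)"
    using sets.sets_into_space[OF S] by (simp add: card Int_absorb2)
  also have "(LINT x | cube_measure {i, j}. w (x i) (x j) * indicator S (x i) * indicator S (x j) *
      measure unit_measure S ^ (card V - 2)) =
      measure unit_measure S ^ (card V - 2) *
      (LINT x | cube_measure {i, j}. w (x i) (x j) * indicator (S \<times> S) (x i, x j))"
  proof -
    have "w (x i) (x j) * indicator S (x i) * indicator S (x j) * measure unit_measure S ^ (card V - 2) =
        measure unit_measure S ^ (card V - 2) * (w (x i) (x j) * indicator (S \<times> S) (x i, x j))" for x
      by (simp only: indicator_times fst_conv snd_conv mult_ac)
    then show ?thesis
      by (simp only: integral_mult_right_zero)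
  qed
  also have "(LINT x | cube_measure {i, j}. w (x i) (x j) * indicator (S \<times> S) (x i, x j)) =
      (LINT p | distr (cube_measure {i, j}) (unit_measure \<Otimes>\<^sub>M unit_measure) (\<lambda>x. (x i, x j)).
        w (fst p) (snd p) * indicator (S \<times> S) p)"
    using wm S by (subst integral_distr[OF pair]) auto
  also have "distr (cube_measure {i, j}) (unit_measure \<Otimes>\<^sub>M unit_measure) (\<lambda>x. (x i, x j)) =
      unit_measure \<Otimes>\<^sub>M unit_measure"
    using V by (intro distr_cube_pair) auto
  finally show "(LINT x | cube_measure V. ?f x) =
      measure unit_measure S ^ (card V - 2) *
      (LINT p | (unit_measure \<Otimes>\<^sub>M unit_measure). w (fst p) (snd p) * indicator (S \<times> S) p)" .
qed

text \<open>
  Taking logarithms turns the constant product into a constant sum over the edges. Integrated over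
  \<open>S\<^sup>V\<close>, all edges contribute the same amount, namely a power of the measure of \<open>S\<close> times the integral
  over \<open>S \<times> S\<close>, whatever the shape of \<open>J\<close> is. Hence all integrals over squares \<open>S \<times> S\<close> are determined,
  and they determine the kernel.
\<close>

lemma edge_product_constant_imp_kernel_constant:
  assumes K: "borel_kernel K" "\<And>x y. 0 \<le> K x y" "\<And>x y. K x y \<le> 1"
    and J: "loopless_graph J" "num_edges J > 0"
    and \<rho>: "0 < \<rho>" "\<rho> \<le> 1"
    and AE: "AE x in cube_measure (verts J). (\<Prod>e\<in>#edges J. edge_factor K x e) = \<rho> ^ num_edges J"
  shows "AE p in lebesgue_on ({0..1} \<times> {0..1}). K (fst p) (snd p) = \<rho>"
proof -
  define V M where "V = verts J" and "M = num_edges J"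
  \<comment> \<open>Almost everywhere the factors are at least \<open>\<rho> ^ M\<close>, so truncating below at \<open>c\<close> changes nothing
    there while making the logarithm bounded. The strict inequality \<open>c < \<rho>\<close> is what allows the last
    step to recover \<open>K = \<rho>\<close> from \<open>max c K = \<rho>\<close>; truncation at \<open>\<rho> ^ M\<close> would fail for \<open>M = 1\<close>.\<close>
  define c where "c = \<rho> ^ M / 2"
  define w where "w x y = ln (max c (K x y)) - ln \<rho>" for x y
  have "finite V"
    using J(1) by (simp add: loopless_graph_def V_def)
  have c: "0 < c" "c < \<rho> ^ M" "\<rho> ^ M \<le> \<rho>" "c < 1"
    using \<rho> J(2) power_decreasing[of 1 M \<rho>] by (auto simp: c_def M_def)
  have [measurable]: "(\<lambda>p. K (fst p) (snd p)) \<in> borel_measurable borel"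
    using K(1) by (simp add: borel_kernel_def)
  have "(\<lambda>p. w (fst p) (snd p)) \<in> borel_measurable borel"
    unfolding w_def by measurable
  then have w: "borel_kernel w"
    using K(1) by (simp add: borel_kernel_def w_def)
  have w_bound: "\<bar>w x y\<bar> \<le> \<bar>ln c\<bar> + \<bar>ln \<rho>\<bar>" for x y
  proof -
    have "ln c \<le> ln (max c (K x y))" "ln (max c (K x y)) \<le> 0"
      using c K(3)[of x y] by simp_all
    then show ?thesis
      by (simp add: w_def)
  qed
  have sum_zero: "AE x in cube_measure V. (\<Sum>e\<in>#edges J. edge_factor w x e) = 0"
    using AE unfolding V_def
  proof eventually_elim
    case (elim x)
    have unit: "0 \<le> edge_factor K x e \<and> edge_factor K x e \<le> 1" for e
      by (rule edge_factor_unit_interval[OF K(2,3)])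
    have big: "c < edge_factor K x e" if "e \<in># edges J" for e
      using prod_mset_le_factor[of "edges J" "edge_factor K x" e] unit that elim c(2) by (simp add: M_def)
    have "edge_factor w x e = ln (edge_factor K x e) - ln \<rho>" if "e \<in># edges J" for e
      using big[OF that] by (simp add: edge_factor_def Let_def w_def)
    then have "(\<Sum>e\<in>#edges J. edge_factor w x e) = (\<Sum>e\<in>#edges J. ln (edge_factor K x e) - ln \<rho>)"
      by (intro arg_cong[where f = sum_mset] image_mset_cong)
    also have "\<dots> = (\<Sum>e\<in>#edges J. ln (edge_factor K x e)) - M * ln \<rho>"
    proof -
      have "(\<Sum>e\<in>#A. ln (edge_factor K x e) - ln \<rho>) =
          (\<Sum>e\<in>#A. ln (edge_factor K x e)) - size A * ln \<rho>" for A
        by (induction A) (simp_all add: algebra_simps)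
      then show ?thesis
        by (simp add: M_def num_edges_def)
    qed
    also have "(\<Sum>e\<in>#edges J. ln (edge_factor K x e)) = ln (\<Prod>e\<in>#edges J. edge_factor K x e)"
      using big c(1) by (intro ln_prod_mset[symmetric]) (auto intro: less_trans)
    also have "\<dots> = M * ln \<rho>"
      using \<rho> by (simp add: elim M_def ln_realpow)
    finally show ?case
      by simp
  qed
  let ?P = "unit_measure \<Otimes>\<^sub>M unit_measure"
  have wm: "(\<lambda>p. w (fst p) (snd p)) \<in> borel_measurable ?P"
    by (rule borel_kernel_measurable_unit_square[OF w])
  have squares: "(LINT p | ?P. w (fst p) (snd p) * indicator (S \<times> S) p) = 0"
    if S: "S \<in> sets unit_measure" for S
  proof (cases "measure unit_measure S = 0")
    case True
    then have "S \<times> S \<in> null_sets ?P"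
      using S by (auto simp: null_sets_def unit.emeasure_pair_measure_Times unit.emeasure_eq_measure)
    then show ?thesis
      by (intro integral_eq_zero_AE) (auto dest!: AE_not_in elim!: eventually_mono simp: indicator_def)
  next
    case False
    let ?Q = "LINT p | ?P. w (fst p) (snd p) * indicator (S \<times> S) p"
    let ?\<mu> = "measure unit_measure S ^ (card V - 2)"
    let ?h = "\<lambda>e x. edge_factor w x e * (\<Prod>v\<in>V. indicator S (x v))"
    have edge: "integrable (cube_measure V) (?h e) \<and> (LINT x | cube_measure V. ?h e x) = ?\<mu> * ?Q"
      if "e \<in># edges J" for e
    proof -
      have e: "e \<subseteq> V" "card e = 2"
        using J(1) that by (auto simp: loopless_graph_def V_def)
      obtain i j where ij: "i \<noteq> j" "e = {i, j}" "\<And>K x. edge_factor K x e = K (x i) (x j)"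
        using edge_endpoints[OF e(2)] by blast
      have "i \<in> V" "j \<in> V"
        using e(1) ij(2) by auto
      from integral_cube_edge_localized[OF w w_bound \<open>finite V\<close> this ij(1) S] show ?thesis
        unfolding ij(3) by blast
    qed
    have "0 = (LINT x | cube_measure V. (\<Sum>e\<in>#edges J. ?h e x))"
    proof (rule integral_eq_zero_AE[symmetric])
      show "AE x in cube_measure V. (\<Sum>e\<in>#edges J. ?h e x) = 0"
        using sum_zero by eventually_elim (simp add: sum_mset_distrib_right[symmetric])
    qed
    also have "\<dots> = (\<Sum>e\<in>#edges J. LINT x | cube_measure V. ?h e x)"
      using edge by (intro integral_sum_mset) blast
    also have "\<dots> = (\<Sum>e\<in>#edges J. ?\<mu> * ?Q)"
      using edge by (intro arg_cong[where f = sum_mset] image_mset_cong) blast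
    also have "\<dots> = M * (?\<mu> * ?Q)"
      by (simp add: M_def num_edges_def)
    finally show ?thesis
      using False J(2) by (simp add: M_def)
  qed
  have "AE p in ?P. w (fst p) (snd p) = 0"
  proof (rule unit_square.AE_eq_0_if_rectangle_integrals_eq_0[OF wm w_bound])
    fix A B assume "A \<in> sets unit_measure" "B \<in> sets unit_measure"
    moreover have "w (fst (x, y)) (snd (x, y)) = w (fst (y, x)) (snd (y, x))" for x y
      using w by (simp add: borel_kernel_def)
    ultimately show "(LINT p | ?P. w (fst p) (snd p) * indicator (A \<times> B) p) = 0"
      using rectangle_integrals_eq_0_if_square_integrals_eq_0[OF wm w_bound _ squares] by blast
  qed
  then have "AE p in ?P. p \<in> {p. K (fst p) (snd p) = \<rho>}"
  proof eventually_elim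
    case (elim p)
    then have "max c (K (fst p) (snd p)) = \<rho>"
      using c(1) \<rho>(1) by (simp add: w_def less_max_iff_disj)
    then show ?case
      using c by (auto simp: max_def split: if_splits)
  qed
  moreover have "{p. K (fst p) (snd p) = \<rho>} \<in> sets borel"
    by measurable
  ultimately have "AE p in lebesgue_on ({0..1} \<times> {0..1}). p \<in> {p. K (fst p) (snd p) = \<rho>}"
    using AE_unit_square_iff by blast
  then show ?thesis
    by simp
qed


section \<open>Comparison of the two densities\<close>

text \<open>
  Each \<open>\<gamma> \<in> \<Gamma>\<close> acts on the cube by a measure-preserving permutation of the coordinates, which turns
  the integrand of \<open>F\<close> into that of the relabelled graph. The right-hand side is thus the integral of
  the arithmetic mean of all relabelled integrands, which dominates their geometric mean, and
  \<open>orbit_geometric_mean\<close> identifies the latter.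
\<close>

lemma integral_edge_product_powr_ge:
  fixes F J :: "'v pre_graph" and q :: real
  assumes K: "borel_kernel K" "\<And>x y. 0 \<le> K x y" "\<And>x y. K x y \<le> 1"
    and F: "loopless_graph F" "num_edges F > 0" and J: "loopless_graph J"
    and FJ: "verts F = verts J" "set_mset (edges F) \<subseteq> set_mset (edges J)"
    and \<Gamma>: "subgroup \<Gamma> (Aut_group J)" "edge_transitive \<Gamma> J"
    and q: "q > 0"
  shows "(LINT x | cube_measure (verts J). (\<Prod>e\<in>#edges J. edge_factor K x e) powr
        (q * num_edges F / num_edges J)) \<le>
      (LINT x | cube_measure (verts J). (\<Prod>e\<in>#edges F. edge_factor K x e powr q))"
proof -
  define V where "V = verts J"
  define H where "H x = (\<Prod>e\<in>#edges F. edge_factor K x e powr q)" for x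
  define G where "G x = (\<Prod>e\<in>#edges J. edge_factor K x e)" for x
  define p where "p = q * num_edges F / num_edges J"
  have unit: "0 \<le> edge_factor K x e \<and> edge_factor K x e \<le> 1" for x :: "'v \<Rightarrow> real" and e
    by (rule edge_factor_unit_interval[OF K(2,3)])
  have H01: "0 \<le> H x" "H x \<le> 1" for x
    using prod_mset_unit_interval[of "edges F" "\<lambda>e. edge_factor K x e powr q"] unit q
    by (simp_all add: H_def powr_le1)
  have Hm: "H \<in> borel_measurable (cube_measure V)"
    using borel_measurable_edge_product[OF borel_kernel_powr[OF K(1), of q] F(1)]
    unfolding H_def V_def FJ(1) edge_factor_kernel_powr .
  have bij: "bij_betw \<gamma> V V" if "\<gamma> \<in> \<Gamma>" for \<gamma>
    using subgroup.subset[OF \<Gamma>(1)] that by (auto simp: Aut_group_def graph_auts_def Bij_def V_def)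
  have fin: "finite \<Gamma>"
    using subgroup.subset[OF \<Gamma>(1)] J
    by (auto simp: Aut_group_def graph_auts_def loopless_graph_def intro: finite_subset[OF _ finite_Bij])
  have "\<Gamma> \<noteq> {}"
    using subgroup.one_closed[OF \<Gamma>(1)] by auto
  have H_permute: "H (\<lambda>v\<in>V. x (\<gamma> v)) = (\<Prod>e\<in>#edges F. edge_factor K x (\<gamma> ` e) powr q)" for x \<gamma>
    unfolding H_def using F(1) FJ(1)
    by (intro arg_cong[where f = prod_mset] image_mset_cong)
      (simp add: edge_factor_permute[OF K(1)] loopless_graph_def V_def)
  have int_H: "integrable (cube_measure V) (\<lambda>x. H (\<lambda>v\<in>V. x (\<gamma> v)))" if "\<gamma> \<in> \<Gamma>" for \<gamma>
    using measurable_compose[OF measurable_permute_cube[OF bij[OF that]] Hm] H01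
    by (intro cube.integrable_const_bound[where B = 1]) auto
  have pointwise: "G x powr p \<le> (\<Sum>\<gamma>\<in>\<Gamma>. H (\<lambda>v\<in>V. x (\<gamma> v)) / card \<Gamma>)" for x
  proof -
    have "G x powr p = (\<Prod>\<gamma>\<in>\<Gamma>. H (\<lambda>v\<in>V. x (\<gamma> v))) powr (1 / card \<Gamma>)"
      unfolding G_def p_def H_permute
      using orbit_geometric_mean[OF J \<Gamma> fin \<open>\<Gamma> \<noteq> {}\<close> FJ(2) F(2), of "edge_factor K x" q] unit by simp
    also have "\<dots> \<le> (\<Sum>\<gamma>\<in>\<Gamma>. H (\<lambda>v\<in>V. x (\<gamma> v)) / card \<Gamma>)"
      by (intro arith_geom_mean fin \<open>\<Gamma> \<noteq> {}\<close> H01)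
    finally show ?thesis .
  qed
  have "(LINT x | cube_measure V. G x powr p) \<le>
      (LINT x | cube_measure V. (\<Sum>\<gamma>\<in>\<Gamma>. H (\<lambda>v\<in>V. x (\<gamma> v)) / card \<Gamma>))"
  proof (rule integral_mono')
    show "integrable (cube_measure V) (\<lambda>x. \<Sum>\<gamma>\<in>\<Gamma>. H (\<lambda>v\<in>V. x (\<gamma> v)) / card \<Gamma>)"
      using int_H by auto
  qed (use pointwise H01 in \<open>auto intro!: sum_nonneg\<close>)
  also have "\<dots> = (\<Sum>\<gamma>\<in>\<Gamma>. (LINT x | cube_measure V. H (\<lambda>v\<in>V. x (\<gamma> v))) / card \<Gamma>)"
    using int_H by (subst Bochner_Integration.integral_sum) auto
  also have "\<dots> = (\<Sum>\<gamma>\<in>\<Gamma>. (LINT x | cube_measure V. H x) / card \<Gamma>)"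
    using integral_permute_cube[OF bij Hm] by simp
  also have "\<dots> = (LINT x | cube_measure V. H x)"
    using fin \<open>\<Gamma> \<noteq> {}\<close> by simp
  finally show ?thesis
    by (simp add: G_def H_def p_def V_def)
qed

text \<open>
  Combining the averaging inequality with Jensen's inequality for the edge product of \<open>J\<close> compares
  the densities of \<open>F\<close> and \<open>J\<close> in an arbitrary graphon. If equality holds with an
  exponent greater than \<open>1\<close>, the edge product is almost everywhere constant.
\<close>

lemma
  fixes F J :: "'v pre_graph" and W :: "real \<Rightarrow> real \<Rightarrow> real" and q \<rho> :: real
  assumes F: "loopless_graph F" "num_edges F > 0" and J: "loopless_graph J" "num_edges J > 0"
    and FJ: "verts F = verts J" "set_mset (edges F) \<subseteq> set_mset (edges J)"
    and \<Gamma>: "subgroup \<Gamma> (Aut_group J)" "edge_transitive \<Gamma> J"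
    and W: "graphon W" and q: "q > 0" "q * num_edges F / num_edges J \<ge> 1"
  shows hom_density_kernel_powr_ge:
      "hom_density F (kernel_powr W q) \<ge> hom_density J W powr (q * num_edges F / num_edges J)"
    and hom_density_kernel_powr_eq_imp_ae_constant:
      "\<lbrakk>q * num_edges F / num_edges J > 1; 0 < \<rho>; \<rho> \<le> 1; hom_density J W = \<rho> ^ num_edges J;
        hom_density F (kernel_powr W q) = hom_density J W powr (q * num_edges F / num_edges J)\<rbrakk>
        \<Longrightarrow> ae_constant W \<rho>"
proof -
  define p where "p = q * num_edges F / num_edges J"
  obtain K where K: "borel_kernel K" "\<And>x y. 0 \<le> K x y" "\<And>x y. K x y \<le> 1"
    and WK: "AE p in lebesgue_on ({0..1} \<times> {0..1}). W (fst p) (snd p) = K (fst p) (snd p)"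
    using graphon_borel_version[OF W] by blast
  define G where "G x = (\<Prod>e\<in>#edges J. edge_factor K x e)" for x
  have J_eq: "hom_density J W = cube.expectation (verts J) G"
    unfolding G_def by (rule hom_density_borel_version[OF WK K(1) J(1)])
  have Gm: "G \<in> borel_measurable (cube_measure (verts J))"
    unfolding G_def by (rule borel_measurable_edge_product[OF K(1) J(1)])
  have "0 \<le> edge_factor K x e \<and> edge_factor K x e \<le> 1" for x :: "'v \<Rightarrow> real" and e
    by (rule edge_factor_unit_interval[OF K(2,3)])
  then have G01: "0 \<le> G x" "G x \<le> 1" for x
    using prod_mset_unit_interval[of "edges J" "edge_factor K x"] by (simp_all add: G_def)
  have WKq: "AE p in lebesgue_on ({0..1} \<times> {0..1}).
      kernel_powr W q (fst p) (snd p) = kernel_powr K q (fst p) (snd p)"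
    using WK by eventually_elim (simp add: kernel_powr_def)
  have "hom_density F (kernel_powr W q) = (LINT x | cube_measure (verts J).
      (\<Prod>e\<in>#edges F. edge_factor K x e powr q))"
    using hom_density_borel_version[OF WKq borel_kernel_powr[OF K(1)] F(1)]
    by (simp add: edge_factor_kernel_powr FJ(1))
  then have F_ge: "hom_density F (kernel_powr W q) \<ge> cube.expectation (verts J) (\<lambda>x. G x powr p)"
    using integral_edge_product_powr_ge[OF K F J(1) FJ \<Gamma> q(1)] by (simp add: G_def p_def)
  have G_ge: "cube.expectation (verts J) (\<lambda>x. G x powr p) \<ge> hom_density J W powr p"
    unfolding J_eq using q(2) by (intro cube.expectation_powr_ge Gm G01) (simp add: p_def)
  from F_ge G_ge
  show "hom_density F (kernel_powr W q) \<ge> hom_density J W powr (q * num_edges F / num_edges J)"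
    by (simp add: p_def)
  assume p: "q * num_edges F / num_edges J > 1" and \<rho>: "0 < \<rho>" "\<rho> \<le> 1"
    and J_\<rho>: "hom_density J W = \<rho> ^ num_edges J"
    and eq: "hom_density F (kernel_powr W q) = hom_density J W powr (q * num_edges F / num_edges J)"
  have "cube.expectation (verts J) (\<lambda>x. G x powr p) = cube.expectation (verts J) G powr p"
    using F_ge G_ge eq by (simp add: J_eq p_def)
  moreover have "cube.expectation (verts J) G > 0"
    using \<rho>(1) J_\<rho> by (simp add: J_eq)
  ultimately have "AE x in cube_measure (verts J). G x = cube.expectation (verts J) G"
    using p q(2) by (intro cube.expectation_powr_eq_imp_AE_const Gm G01) (simp_all add: p_def)
  then have "AE x in cube_measure (verts J). G x = \<rho> ^ num_edges J"
    using J_\<rho> by (simp add: J_eq)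
  then have "AE p in lebesgue_on ({0..1} \<times> {0..1}). K (fst p) (snd p) = \<rho>"
    unfolding G_def by (rule edge_product_constant_imp_kernel_constant[OF K J \<rho>])
  with WK show "ae_constant W \<rho>"
    unfolding ae_constant_def by eventually_elim simp
qed

theorem theorem1p3:
  fixes F J :: "'v pre_graph" and \<Gamma> :: "('v \<Rightarrow> 'v) set" and q :: real
  assumes "loopless_graph F" and "simple_graph J" and "verts F = verts J"
    and "num_edges F > 0"
    and "subgraph_of (supp_graph F) J"
    and "KNRS J"
    and "subgroup \<Gamma> (Aut_group J)" and "edge_transitive \<Gamma> J"
    and "q \<ge> real (num_edges J) / real (num_edges F)"
  shows "(\<forall>\<rho>\<in>{0..1}. \<forall>W. graphon W \<and> locally_dense \<rho> W \<longrightarrow>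
            hom_density F (kernel_powr W q) \<ge> \<rho> powr (q * real (num_edges F)))
       \<and> (q > real (num_edges J) / real (num_edges F) \<or> KNRS_forcing J \<longrightarrow>
            (\<forall>\<rho>\<in>{0<..<1}. \<forall>W. graphon W \<and> locally_dense \<rho> W \<longrightarrow>
               (hom_density F (kernel_powr W q) = \<rho> powr (q * real (num_edges F))
                  \<longleftrightarrow> ae_constant W \<rho>)))"
proof -
  define m M p where "m = num_edges F" and "M = num_edges J" and "p = q * m / M"
  have J: "loopless_graph J"
    using assms(2) by (simp add: simple_graph_def)
  have FJ: "set_mset (edges F) \<subseteq> set_mset (edges J)"
    using assms(5) by (auto simp: subgraph_of_def supp_graph_def dest!: set_mset_mono)
  have "m > 0"
    using assms(4) by (simp add: m_def)
  then have "edges F \<noteq> {#}"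
    by (auto simp: m_def num_edges_def)
  then have "M > 0"
    using FJ by (auto simp: M_def num_edges_def nonempty_has_size[symmetric])
  have "q > 0"
    using assms(9) \<open>m > 0\<close> \<open>M > 0\<close> unfolding m_def M_def
    by (metis divide_pos_pos less_le_trans of_nat_0_less_iff)
  have "p \<ge> 1"
    using assms(9) \<open>m > 0\<close> \<open>M > 0\<close> by (simp add: p_def m_def M_def field_simps)
  have p_gt: "p > 1" if "q > M / m"
    using that \<open>m > 0\<close> \<open>M > 0\<close> by (simp add: p_def field_simps)
  have power_p: "(\<rho> ^ M) powr p = \<rho> powr (q * m)" if "\<rho> \<ge> 0" for \<rho> :: real
    using that \<open>M > 0\<close> by (cases "\<rho> = 0") (simp_all add: p_def powr_powr flip: powr_realpow)
  have F_ge_J: "hom_density F (kernel_powr W q) \<ge> hom_density J W powr p" if "graphon W" for W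
    unfolding p_def m_def M_def
    by (rule hom_density_kernel_powr_ge[OF assms(1,4) J _ assms(3) FJ assms(7,8) that \<open>q > 0\<close>])
      (use \<open>M > 0\<close> \<open>p \<ge> 1\<close> in \<open>simp_all add: p_def m_def M_def\<close>)
  have J_ge: "hom_density J W \<ge> \<rho> ^ M" if "\<rho> \<in> {0..1}" "graphon W" "locally_dense \<rho> W" for \<rho> W
    using assms(6) that by (auto simp: KNRS_def M_def)
  have J_ge_powr: "hom_density J W powr p \<ge> \<rho> powr (q * m)"
    if "\<rho> \<in> {0..1}" "graphon W" "locally_dense \<rho> W" for \<rho> W
    using powr_mono2[OF _ _ J_ge[OF that], of p] that(1) \<open>p \<ge> 1\<close> by (simp add: power_p)
  have F_ge: "hom_density F (kernel_powr W q) \<ge> \<rho> powr (q * m)"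
    if "\<rho> \<in> {0..1}" "graphon W" "locally_dense \<rho> W" for \<rho> W
    using J_ge_powr[OF that] F_ge_J[OF that(2)] by (rule order_trans)
  have forward: "ae_constant W \<rho>"
    if strict: "q > M / m \<or> KNRS_forcing J" and \<rho>: "\<rho> \<in> {0<..<1}"
      and W: "graphon W" "locally_dense \<rho> W"
      and eq: "hom_density F (kernel_powr W q) = \<rho> powr (q * m)" for \<rho> W
  proof -
    have \<rho>': "\<rho> \<in> {0..1}"
      using \<rho> by auto
    have "hom_density J W powr p \<le> (\<rho> ^ M) powr p"
      using F_ge_J[OF W(1)] eq power_p[of \<rho>] \<rho> by simp
    then have "hom_density J W \<le> \<rho> ^ M"
      using \<open>p \<ge> 1\<close> \<rho> J_ge[OF \<rho>' W] powr_less_mono2[of p "\<rho> ^ M" "hom_density J W"] by force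
    then have J_eq: "hom_density J W = \<rho> ^ M"
      using J_ge[OF \<rho>' W] by simp
    from strict show ?thesis
    proof
      assume "q > M / m"
      then have "p > 1"
        by (rule p_gt)
      moreover have "hom_density F (kernel_powr W q) = hom_density J W powr p"
        using \<rho> by (simp add: J_eq eq power_p)
      ultimately show ?thesis
        using \<rho> J_eq \<open>M > 0\<close> \<open>q > 0\<close> unfolding p_def m_def M_def
        by (intro hom_density_kernel_powr_eq_imp_ae_constant[OF assms(1,4) J _ assms(3) FJ assms(7,8) W(1)])
          simp_all
    next
      assume "KNRS_forcing J"
      then show ?thesis
        using \<rho> W J_eq by (simp add: KNRS_forcing_def M_def)
    qed
  qed
  have backward: "hom_density F (kernel_powr W q) = \<rho> powr (q * m)"
    if "ae_constant W \<rho>" for \<rho> W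
  proof -
    have AE: "AE p in lebesgue_on ({0..1} \<times> {0..1}).
        kernel_powr W q (fst p) (snd p) = (\<lambda>_ _. \<rho> powr q) (fst p) (snd p)"
      using that unfolding ae_constant_def by eventually_elim (simp add: kernel_powr_def)
    have "hom_density F (kernel_powr W q) = (LINT x | cube_measure (verts F). (\<rho> powr q) ^ m)"
      using hom_density_borel_version[OF AE _ assms(1)]
      by (simp add: borel_kernel_def edge_factor_def m_def num_edges_def)
    then show ?thesis
      using \<open>m > 0\<close> by (simp add: cube.P.prob_space power_of_powr)
  qed
  show ?thesis
    using F_ge forward backward unfolding m_def M_def by blast
qed

end
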